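(* Let $p\in\mathbb R^3$, $\mathbf n\in S^2$, $\theta\in\,]0,\frac{\pi}{2}[$, $\delta>0$, and let $\omega\in S^2$ satisfy $\omega\cdot\mathbf n>\sin\theta$. Let $Q=V_p(-\mathbf n,\theta)\cap\{x\in\mathbb R^3: x\cdot\omega=p\cdot\omega-\delta\}$. Then for every $\vartheta\in S^2$ with $\vartheta\cdot\omega=0$, $$C_{(p,\omega)}(\delta,Q,\vartheta)=6\,V(\theta)\,\bigl(\mathbf n\cdot(\omega+i\vartheta)\bigr)^{-3},\qquad V(\theta)=\frac{\pi}{3}\cos\theta\,\sin^2\theta.$$
   Context: $V_p(-\mathbf n,\theta)=\{x\in\mathbb R^3: (x-p)\cdot(-\mathbf n)>|x-p|\cos\theta\}$ is the inside of the circular cone with apex $p$ and opening angle $\theta$ around the direction $-\mathbf n$. Under $\omega\cdot\mathbf n>\sin\theta$, $Q$ is a nonempty bounded relatively open subset (the inside of an ellipse) of the plane $x\cdot\omega=p\cdot\omega-\delta$. For a nonempty bounded relatively open subset $Q$ of the plane $x\cdot\omega=p\cdot\omega-\delta$, let $D_{(p,\omega)}(\delta,Q)=\bigcup_{0<s<\delta}\{p+\frac{s}{\delta}(z-p): z\in Q\}$ and, for $\vartheta\in S^2$ with $\vartheta\cdot\omega=0$, $$C_{(p,\omega)}(\delta,Q,\vartheta)=2s\int_{Q_s}\frac{dS_z}{\{s-i(z-p)\cdot\vartheta\}^3},\qquad Q_s=D_{(p,\omega)}(\delta,Q)\cap\{x: x\cdot\omega=p\cdot\omega-s\},$$ which does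 not depend on $s\in\,]0,\delta[$. Dot products are extended bilinearly (no conjugation) to complex vectors. *)

theory Defs
  imports "HOL-Analysis.Analysis"
begin

definition circ_cone :: "real^3 \<Rightarrow> real^3 \<Rightarrow> real \<Rightarrow> (real^3) set" where
  "circ_cone p d \<theta> = {x. (x - p) \<bullet> d > norm (x - p) * cos \<theta>}"

definition plane :: "real^3 \<Rightarrow> real \<Rightarrow> (real^3) set" where
  "plane \<omega> c = {x. x \<bullet> \<omega> = c}"

definition cone_frustum :: "real^3 \<Rightarrow> real \<Rightarrow> (real^3) set \<Rightarrow> (real^3) set" where
  "cone_frustum p \<delta> Q = (\<Union>s\<in>{0<..<\<delta>}. (\<lambda>z. p + (s / \<delta>) *\<^sub>R (z - p)) ` Q)"

definition cone_slice :: "real^3 \<Rightarrow> real^3 \<Rightarrow> real \<Rightarrow> (real^3) set \<Rightarrow> real \<Rightarrow> (real^3) set" where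
  "cone_slice p \<omega> \<delta> Q s = cone_frustum p \<delta> Q \<inter> plane \<omega> (p \<bullet> \<omega> - s)"

definition plane_frame :: "real^3 \<Rightarrow> real^3 \<Rightarrow> real^3 \<Rightarrow> bool" where
  "plane_frame \<omega> a b \<longleftrightarrow>
     norm a = 1 \<and> norm b = 1 \<and> a \<bullet> b = 0 \<and> a \<bullet> \<omega> = 0 \<and> b \<bullet> \<omega> = 0"

definition plane_chart :: "real^3 \<Rightarrow> real^3 \<Rightarrow> real^3 \<Rightarrow> real \<times> real \<Rightarrow> real^3" where
  "plane_chart x0 a b = (\<lambda>(u, v). x0 + u *\<^sub>R a + v *\<^sub>R b)"

text \<open>Surface measure \<open>dS\<close> on the plane \<open>x \<bullet> \<omega> = c\<close> for a unit vector \<open>\<omega>\<close>: the image of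
  two-dimensional Lebesgue measure under an isometric parametrization of the plane. The choice of
  base point and frame is immaterial by \<open>plane_area_eq\<close> below.\<close>

definition plane_area :: "real^3 \<Rightarrow> real \<Rightarrow> (real^3) measure" where
  "plane_area \<omega> c =
     (let (a, b) = (SOME (a, b). plane_frame \<omega> a b)
      in distr lborel borel (plane_chart (c *\<^sub>R \<omega>) a b))"

definition C_slice ::
  "real^3 \<Rightarrow> real^3 \<Rightarrow> real \<Rightarrow> (real^3) set \<Rightarrow> real^3 \<Rightarrow> real \<Rightarrow> complex" where
  "C_slice p \<omega> \<delta> Q \<tau> s =
     2 * of_real s *
     (LINT z:cone_slice p \<omega> \<delta> Q s|plane_area \<omega> (p \<bullet> \<omega> - s).
        1 / (of_real s - \<i> * of_real ((z - p) \<bullet> \<tau>)) ^ 3)"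

text \<open>The common value for \<open>0 < s < \<delta>\<close>; see \<open>C_const_eq\<close> below.\<close>

definition C_const ::
  "real^3 \<Rightarrow> real^3 \<Rightarrow> real \<Rightarrow> (real^3) set \<Rightarrow> real^3 \<Rightarrow> complex" where
  "C_const p \<omega> \<delta> Q \<tau> = (THE c. \<forall>s\<in>{0<..<\<delta>}. C_slice p \<omega> \<delta> Q \<tau> s = c)"

definition cvec :: "real^'n \<Rightarrow> complex^'n" where
  "cvec x = (\<chi> j. of_real (x $ j))"

text \<open>The bilinear dot product; the inner product \<open>\<bullet>\<close> on \<open>complex^'n\<close> is instead real-valued.\<close>

definition cdot :: "complex^'n \<Rightarrow> complex^'n \<Rightarrow> complex" where
  "cdot x y = (\<Sum>j\<in>UNIV. x $ j * y $ j)"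

definition cone_volume :: "real \<Rightarrow> real" where
  "cone_volume \<theta> = pi / 3 * cos \<theta> * (sin \<theta>)\<^sup>2"


lemma plane_chart_measurable [measurable]: "plane_chart x0 a b \<in> borel_measurable borel"
  unfolding plane_chart_def split_beta
  by (intro borel_measurable_continuous_onI continuous_intros)

lemma plane_frame_exists:
  fixes \<omega> :: "real^3"
  assumes "norm \<omega> = 1"
  shows "\<exists>a b. plane_frame \<omega> a b"
proof -
  obtain f :: "real^3 \<Rightarrow> real^3" where f: "orthogonal_transformation f" "f (axis 1 1) = \<omega>"
    using orthogonal_transformation_exists_1[of "axis 1 1" \<omega>] assms by auto
  have "plane_frame \<omega> (f (axis 2 1)) (f (axis 3 1))"
    using f(1) unfolding plane_frame_def f(2)[symmetric]
    by (auto simp: orthogonal_transformation_norm orthogonal_transformation_def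
        inner_axis_axis)
  then show ?thesis by blast
qed

lemma plane_frame_expand:
  assumes "norm \<omega> = 1" "plane_frame \<omega> a b"
  shows "x = (x \<bullet> \<omega>) *\<^sub>R \<omega> + (x \<bullet> a) *\<^sub>R a + (x \<bullet> b) *\<^sub>R b"
proof -
  have pw: "pairwise orthogonal {\<omega>, a, b}"
    and nz: "\<omega> \<noteq> 0" "a \<noteq> 0" "b \<noteq> 0"
    and nn: "\<omega> \<bullet> \<omega> = 1" "a \<bullet> a = 1" "b \<bullet> b = 1"
    and oo: "a \<bullet> b = 0" "a \<bullet> \<omega> = 0" "b \<bullet> \<omega> = 0"
    using assms by (auto simp: plane_frame_def pairwise_insert orthogonal_def inner_commute
        norm_eq_1)
  have dis: "\<omega> \<noteq> a" "\<omega> \<noteq> b" "a \<noteq> b"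
    using nn oo by auto
  have ind: "independent {\<omega>, a, b}"
    using pairwise_orthogonal_independent[OF pw] nz by auto
  have card: "card {\<omega>, a, b} = 3"
    using dis by auto
  have "span {\<omega>, a, b} = UNIV"
    using card_ge_dim_independent[of "{\<omega>, a, b}" UNIV] ind card by auto
  moreover define y where "y = x - ((x \<bullet> \<omega>) *\<^sub>R \<omega> + (x \<bullet> a) *\<^sub>R a + (x \<bullet> b) *\<^sub>R b)"
  have "orthogonal y z" if "z \<in> {\<omega>, a, b}" for z
    using that nn oo
    by (auto simp: y_def orthogonal_def inner_diff_left inner_add_left inner_diff_right
        inner_add_right inner_commute)
  then have "orthogonal y z" if "z \<in> span {\<omega>, a, b}" for z
    using orthogonal_to_span that by blast
  ultimately have "orthogonal y y" by auto
  then show ?thesis by (simp add: y_def orthogonal_self)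
qed

lemma lborel_rotate:
  fixes c d e f :: real
  assumes "c\<^sup>2 + e\<^sup>2 = 1" "d\<^sup>2 + f\<^sup>2 = 1" "c * d + e * f = 0"
  shows "distr lborel borel (\<lambda>(u, v). (c * u + d * v, e * u + f * v)) = (lborel :: (real \<times> real) measure)"
proof -
  define J :: "real^2 \<Rightarrow> real \<times> real" where "J x = (x $ 1, x $ 2)" for x
  define R :: "real^2 \<Rightarrow> real^2" where
    "R x = vector [c * x $ 1 + d * x $ 2, e * x $ 1 + f * x $ 2]" for x
  define T :: "real \<times> real \<Rightarrow> real \<times> real" where
    "T = (\<lambda>(u, v). (c * u + d * v, e * u + f * v))"
  have Jm [measurable]: "J \<in> borel_measurable borel"
    unfolding J_def by (intro borel_measurable_continuous_onI continuous_intros)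
  have Tm [measurable]: "T \<in> borel_measurable borel"
    unfolding T_def split_beta by (intro borel_measurable_continuous_onI continuous_intros)
  have linR: "linear R"
    by (rule linearI) (simp_all add: R_def vec_eq_iff forall_2 algebra_simps)
  have orth: "orthogonal_transformation R"
    unfolding orthogonal_transformation norm_eq_sqrt_inner
  proof (intro conjI allI linR)
    fix v :: "real^2"
    have "R v \<bullet> R v = (c\<^sup>2 + e\<^sup>2) * (v $ 1)\<^sup>2 + (d\<^sup>2 + f\<^sup>2) * (v $ 2)\<^sup>2
        + 2 * (c * d + e * f) * (v $ 1 * v $ 2)"
      by (simp add: R_def inner_vec_def sum_2 power2_eq_square algebra_simps)
    then show "sqrt (R v \<bullet> R v) = sqrt (v \<bullet> v)"
      using assms by (simp add: inner_vec_def sum_2 flip: power2_eq_square)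
  qed
  have Rm [measurable]: "R \<in> borel_measurable borel"
    using linear_continuous_on[of R UNIV] linR
    by (intro borel_measurable_continuous_onI) (simp add: linear_conv_bounded_linear)
  have bR: "distr lborel borel R = lborel"
  proof (rule sym, rule lborel_eqI)
    fix l u :: "real^2"
    assume le: "\<And>b. b \<in> Basis \<Longrightarrow> l \<bullet> b \<le> u \<bullet> b"
    obtain g where g: "orthogonal_transformation g" "g = inv R" "\<And>x. R (g x) = x" "\<And>x. g (R x) = x"
      using orthogonal_transformation_inv[OF orth] orthogonal_transformation_bij[OF orth]
      by (metis bij_inv_eq_iff)
    have vi: "R -` box l u = g ` box l u"
      using g(3,4) by (auto simp: image_iff) (metis g(4))
    have lm: "g ` box l u \<in> lmeasurable" "measure lebesgue (g ` box l u) = measure lebesgue (box l u)"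
      using measurable_orthogonal_image[OF g(1), of "box l u"]
        measure_orthogonal_image[OF g(1), of "box l u"] by auto
    have sb: "R -` box l u \<in> sets borel"
      using measurable_sets[OF Rm, of "box l u"] by simp
    have "emeasure (distr lborel borel R) (box l u) = emeasure lborel (R -` box l u)"
      by (subst emeasure_distr) auto
    also have "\<dots> = emeasure lebesgue (g ` box l u)"
      using sb by (simp add: vi)
    also have "\<dots> = ennreal (measure lebesgue (box l u))"
      using lm by (simp add: emeasure_eq_measure2)
    also have "\<dots> = ennreal (\<Prod>b\<in>Basis. (u - l) \<bullet> b)"
      using le by (simp add: measure_lborel_box_eq)
    finally show "emeasure (distr lborel borel R) (box l u) = ennreal (\<Prod>b\<in>Basis. (u - l) \<bullet> b)" .
  qed simp
  have bJ: "distr lborel borel J = lborel"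
  proof (rule sym, rule lborel_eqI)
    fix l u :: "real \<times> real"
    assume le: "\<And>b. b \<in> Basis \<Longrightarrow> l \<bullet> b \<le> u \<bullet> b"
    obtain l1 l2 u1 u2 where lu: "l = (l1, l2)" "u = (u1, u2)" by (cases l, cases u)
    have le': "l1 \<le> u1" "l2 \<le> u2"
      using le[of "(1, 0)"] le[of "(0, 1)"] by (auto simp: lu Basis_prod_def)
    have B: "Basis = {axis 1 1, axis 2 1 :: real^2}"
      by (auto simp: Basis_vec_def UNIV_2)
    have vi: "J -` box l u = box (vector [l1, l2]) (vector [u1, u2])"
      by (auto simp: J_def lu mem_box Basis_prod_def B inner_axis)
    have "emeasure (distr lborel borel J) (box l u) = emeasure lborel (J -` box l u)"
      by (subst emeasure_distr) auto
    also have "\<dots> = ennreal (\<Prod>b\<in>Basis. (vector [u1, u2] - vector [l1, l2] :: real^2) \<bullet> b)"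
      unfolding vi
    proof (rule emeasure_lborel_box)
      fix b :: "real^2" assume "b \<in> Basis"
      then show "vector [l1, l2] \<bullet> b \<le> vector [u1, u2] \<bullet> b"
        unfolding B using le' by (auto simp: inner_axis)
    qed
    also have "(\<Prod>b\<in>Basis. (vector [u1, u2] - vector [l1, l2] :: real^2) \<bullet> b) = (u1 - l1) * (u2 - l2)"
      by (simp add: B inner_axis axis_eq_axis)
    also have "\<dots> = (\<Prod>b\<in>Basis. (u - l) \<bullet> b)"
      by (simp add: lu Basis_prod_def)
    finally show "emeasure (distr lborel borel J) (box l u) = ennreal (\<Prod>b\<in>Basis. (u - l) \<bullet> b)" .
  qed simp
  have comm: "T \<circ> J = J \<circ> R"
    by (auto simp: T_def J_def R_def fun_eq_iff)
  have "distr lborel borel T = distr (distr lborel borel J) borel T"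
    by (simp add: bJ)
  also have "\<dots> = distr lborel borel (T \<circ> J)"
    by (rule distr_distr) auto
  also have "\<dots> = distr (distr lborel borel R) borel J"
    unfolding comm by (rule distr_distr[symmetric]) auto
  also have "\<dots> = lborel"
    by (simp add: bR bJ)
  finally show ?thesis by (simp add: T_def)
qed

lemma lborel_shift:
  fixes t :: "'a::euclidean_space"
  shows "distr lborel borel (\<lambda>x. t + x) = lborel"
  using lborel_affine[of 1 t] by (simp add: density_1)

lemma plane_chart_frame_indep:
  assumes \<omega>: "norm \<omega> = 1" and ab: "plane_frame \<omega> a b" and ab': "plane_frame \<omega> a' b'"
    and x: "x0 \<bullet> \<omega> = c" "x0' \<bullet> \<omega> = c"
  shows "distr lborel borel (plane_chart x0 a b) = distr lborel borel (plane_chart x0' a' b')"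
proof -
  define R :: "real \<times> real \<Rightarrow> real \<times> real" where
    "R = (\<lambda>(u, v). ((a' \<bullet> a) * u + (b' \<bullet> a) * v, (a' \<bullet> b) * u + (b' \<bullet> b) * v))"
  define t where "t = ((x0' - x0) \<bullet> a, (x0' - x0) \<bullet> b)"
  have nn: "a' \<bullet> a' = 1" "b' \<bullet> b' = 1" "a' \<bullet> b' = 0" "a' \<bullet> \<omega> = 0" "b' \<bullet> \<omega> = 0"
    using ab' by (auto simp: plane_frame_def norm_eq_1)
  note ea = plane_frame_expand[OF \<omega> ab, of a'] and eb = plane_frame_expand[OF \<omega> ab, of b']
  have ea': "a' = (a' \<bullet> a) *\<^sub>R a + (a' \<bullet> b) *\<^sub>R b" and eb': "b' = (b' \<bullet> a) *\<^sub>R a + (b' \<bullet> b) *\<^sub>R b"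
    using ea eb nn by auto
  have ex: "x0' = x0 + fst t *\<^sub>R a + snd t *\<^sub>R b"
    using plane_frame_expand[OF \<omega> ab, of "x0' - x0"] x by (simp add: t_def inner_diff_left algebra_simps)
  have p1: "(a' \<bullet> a)\<^sup>2 + (a' \<bullet> b)\<^sup>2 = 1"
    using nn(1) arg_cong[OF ea', of "\<lambda>z. a' \<bullet> z"] by (simp add: inner_add_right power2_eq_square)
  have p2: "(b' \<bullet> a)\<^sup>2 + (b' \<bullet> b)\<^sup>2 = 1"
    using nn(2) arg_cong[OF eb', of "\<lambda>z. b' \<bullet> z"] by (simp add: inner_add_right power2_eq_square)
  have p3: "(a' \<bullet> a) * (b' \<bullet> a) + (a' \<bullet> b) * (b' \<bullet> b) = 0"
    using nn(3) arg_cong[OF eb', of "\<lambda>z. a' \<bullet> z"] by (simp add: inner_add_right mult.commute)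
  have Rm [measurable]: "R \<in> borel_measurable borel"
    unfolding R_def split_beta by (intro borel_measurable_continuous_onI continuous_intros)
  have comp: "plane_chart x0' a' b' = plane_chart x0 a b \<circ> ((\<lambda>x. t + x) \<circ> R)"
  proof
    fix w :: "real \<times> real"
    obtain u v where w: "w = (u, v)" by (cases w)
    have "plane_chart x0' a' b' w = x0' + u *\<^sub>R a' + v *\<^sub>R b'"
      by (simp add: plane_chart_def w)
    also have "\<dots> = x0 + fst t *\<^sub>R a + snd t *\<^sub>R b
        + u *\<^sub>R ((a' \<bullet> a) *\<^sub>R a + (a' \<bullet> b) *\<^sub>R b) + v *\<^sub>R ((b' \<bullet> a) *\<^sub>R a + (b' \<bullet> b) *\<^sub>R b)"
      using ex ea' eb' by simp
    also have "\<dots> = (plane_chart x0 a b \<circ> ((\<lambda>x. t + x) \<circ> R)) w"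
      by (simp add: plane_chart_def w R_def split_beta algebra_simps)
    finally show "plane_chart x0' a' b' w = (plane_chart x0 a b \<circ> ((\<lambda>x. t + x) \<circ> R)) w" .
  qed
  have "distr lborel borel (plane_chart x0' a' b')
      = distr (distr lborel borel ((\<lambda>x. t + x) \<circ> R)) borel (plane_chart x0 a b)"
    unfolding comp by (rule distr_distr[symmetric]) auto
  also have "distr lborel borel ((\<lambda>x. t + x) \<circ> R) = distr (distr lborel borel R) borel (\<lambda>x. t + x)"
    by (rule distr_distr[symmetric]) auto
  also have "distr lborel borel R = lborel"
    unfolding R_def by (rule lborel_rotate) (fact p1 p2 p3)+
  also have "distr lborel borel (\<lambda>x. t + x) = lborel"
    by (rule lborel_shift)
  finally show ?thesis by simp
qed

lemma plane_area_eq: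
  assumes "norm \<omega> = 1" "plane_frame \<omega> a b" "x0 \<bullet> \<omega> = c"
  shows "plane_area \<omega> c = distr lborel borel (plane_chart x0 a b)"
proof -
  obtain a' b' where eq: "(SOME (a, b). plane_frame \<omega> a b) = (a', b')"
    by (meson surj_pair)
  have "case (a', b') of (a, b) \<Rightarrow> plane_frame \<omega> a b"
    unfolding eq[symmetric] by (rule someI[of _ "(a, b)"]) (use assms in simp)
  then have "plane_frame \<omega> a' b'" by simp
  moreover have "(c *\<^sub>R \<omega>) \<bullet> \<omega> = c"
    using assms(1) by (simp add: norm_eq_1)
  ultimately show ?thesis
    using plane_chart_frame_indep[OF assms(1) _ assms(2) _ assms(3)] eq
    by (simp add: plane_area_def)
qed

lemma cone_slice_eq:
  assumes "Q \<subseteq> plane \<omega> (p \<bullet> \<omega> - \<delta>)" "0 < s" "s < \<delta>"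
  shows "cone_slice p \<omega> \<delta> Q s = (\<lambda>z. p + (s / \<delta>) *\<^sub>R (z - p)) ` Q"
proof -
  have *: "(p + (r / \<delta>) *\<^sub>R (z - p)) \<bullet> \<omega> = p \<bullet> \<omega> - r" if "z \<in> Q" for z r
  proof -
    have "(z - p) \<bullet> \<omega> = - \<delta>"
      using assms(1) that by (auto simp: plane_def inner_diff_left)
    then show ?thesis
      using assms(2,3) by (simp add: inner_add_left)
  qed
  show ?thesis
    using * assms(2,3) by (fastforce simp: cone_slice_def cone_frustum_def plane_def)
qed

lemma C_slice_eq:
  assumes \<omega>: "norm \<omega> = 1" and \<tau>: "\<tau> \<bullet> \<omega> = 0" and Q: "Q \<subseteq> plane \<omega> (p \<bullet> \<omega> - \<delta>)" and Qm: "Q \<in> sets borel"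
    and s: "0 < s" "s < \<delta>"
  shows "C_slice p \<omega> \<delta> Q \<tau> s = 2 * of_real \<delta> *
     (LINT z:Q|plane_area \<omega> (p \<bullet> \<omega> - \<delta>). 1 / (of_real \<delta> - \<i> * of_real ((z - p) \<bullet> \<tau>)) ^ 3)"
proof -
  define k where "k = s / \<delta>"
  define h where "h = (\<lambda>z. p + k *\<^sub>R (z - p))"
  define h' where "h' = (\<lambda>z. p + (1 / k) *\<^sub>R (z - p))"
  have k: "k > 0" "s = k * \<delta>" using s by (auto simp: k_def)
  have S: "cone_slice p \<omega> \<delta> Q s = h ` Q"
    using cone_slice_eq[OF Q s] by (simp add: h_def k_def)
  have hh: "h (h' z) = z" "h' (h z) = z" for z
    using k by (auto simp: h_def h'_def)
  have "h ` Q = h' -` Q"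
    using hh by (auto simp: image_iff) (metis hh(1))
  moreover have "h' \<in> borel_measurable borel"
    unfolding h'_def by (intro borel_measurable_continuous_onI continuous_intros)
  ultimately have Sm: "h ` Q \<in> sets borel"
    using measurable_sets[of h' borel borel Q] Qm by simp
  obtain a b where ab: "plane_frame \<omega> a b" using plane_frame_exists[OF \<omega>] by blast
  have ww: "\<omega> \<bullet> \<omega> = 1" using \<omega> by (simp add: norm_eq_1)
  define F where "F = (\<lambda>r z. 1 / (of_real r - \<i> * of_real ((z - p) \<bullet> \<tau>)) ^ 3 :: complex)"
  have Fm: "F r \<in> borel_measurable borel" for r
    unfolding F_def by measurable
  define G where "G = (\<lambda>r. plane_chart (p - r *\<^sub>R \<omega>) a b)"
  have Gm [measurable]: "G r \<in> borel_measurable borel" for r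
    by (simp add: G_def)
  have P: "plane_area \<omega> (p \<bullet> \<omega> - r) = distr lborel borel (G r)" for r
    unfolding G_def by (rule plane_area_eq[OF \<omega> ab]) (simp add: inner_diff_left ww)
  have I: "(LINT z:A|plane_area \<omega> (p \<bullet> \<omega> - r). F r z)
      = (LINT w|lborel. indicator A (G r w) *\<^sub>R F r (G r w))" if "A \<in> sets borel" for A r
    unfolding set_lebesgue_integral_def P
    by (rule integral_distr) (use that Fm in measurable)
  have Gs: "G s (k *\<^sub>R w) = h (G \<delta> w)" for w
    by (cases w) (simp add: G_def plane_chart_def h_def k(2) algebra_simps)
  have Fs: "F s (h z) = F \<delta> z / of_real (k ^ 3)" for z
  proof -
    have "of_real s - \<i> * of_real ((h z - p) \<bullet> \<tau>)
        = of_real k * (of_real \<delta> - \<i> * of_real ((z - p) \<bullet> \<tau>) :: complex)"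
      by (simp add: h_def k(2) algebra_simps)
    then show ?thesis by (simp add: F_def power_mult_distrib)
  qed
  have inds: "indicator (h ` Q) (h z) = (indicator Q z :: real)" for z
    using hh(2) by (auto simp: indicator_def image_iff) metis
  have "(LINT w|lborel. indicator (h ` Q) (G s w) *\<^sub>R F s (G s w))
     = (LINT w|density (distr lborel borel (\<lambda>x. 0 + k *\<^sub>R x)) (\<lambda>_. \<bar>k\<bar> ^ DIM(real \<times> real)).
          indicator (h ` Q) (G s w) *\<^sub>R F s (G s w))"
    using lborel_affine[of k "0 :: real \<times> real"] k by simp
  also have "\<dots> = (LINT w|distr lborel borel (\<lambda>x. k *\<^sub>R x). k\<^sup>2 *\<^sub>R
          (indicator (h ` Q) (G s w) *\<^sub>R F s (G s w)))"
    using k Sm Fm by (subst integral_density) (auto simp: power2_eq_square intro!: measurable_compose[OF Gm])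
  also have "\<dots> = (LINT w|lborel. k\<^sup>2 *\<^sub>R
          (indicator (h ` Q) (G s (k *\<^sub>R w)) *\<^sub>R F s (G s (k *\<^sub>R w))))"
    using Sm Fm by (subst integral_distr) (auto intro!: measurable_compose[OF Gm])
  also have "\<dots> = (LINT w|lborel. (1 / of_real k) * (indicator Q (G \<delta> w) *\<^sub>R F \<delta> (G \<delta> w)))"
    unfolding Gs Fs inds using k(1) by (intro Bochner_Integration.integral_cong)
      (simp_all add: scaleR_conv_of_real power2_eq_square power3_eq_cube)
  also have "\<dots> = (1 / of_real k) * (LINT w|lborel. indicator Q (G \<delta> w) *\<^sub>R F \<delta> (G \<delta> w))"
    by (rule integral_mult_right_zero)
  finally have key: "(LINT z:h ` Q|plane_area \<omega> (p \<bullet> \<omega> - s). F s z)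
      = (1 / of_real k) * (LINT z:Q|plane_area \<omega> (p \<bullet> \<omega> - \<delta>). F \<delta> z)"
    using I[OF Sm, of s] I[OF Qm, of \<delta>] by simp
  then show ?thesis
    using k unfolding C_slice_def S F_def by simp
qed

lemma C_const_eq:
  assumes "norm \<omega> = 1" "\<tau> \<bullet> \<omega> = 0"
    and "openin (top_of_set (plane \<omega> (p \<bullet> \<omega> - \<delta>))) Q" and "0 < s" "s < \<delta>"
  shows "C_const p \<omega> \<delta> Q \<tau> = C_slice p \<omega> \<delta> Q \<tau> s"
proof -
  have "closed (plane \<omega> (p \<bullet> \<omega> - \<delta>))"
    using closed_hyperplane[of \<omega>] by (simp add: plane_def inner_commute)
  then have Qm: "Q \<in> sets borel"
    using assms(3) by (auto simp: openin_open borel_closed)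
  note eq = C_slice_eq[OF assms(1,2) openin_imp_subset[OF assms(3)] Qm]
  have const: "C_slice p \<omega> \<delta> Q \<tau> r = C_slice p \<omega> \<delta> Q \<tau> s" if "r \<in> {0<..<\<delta>}" for r
    using that by (intro eq[THEN trans, OF _ _ eq[symmetric]] assms(4,5)) auto
  show ?thesis
    unfolding C_const_def
  proof (rule the_equality)
    show "\<forall>r\<in>{0<..<\<delta>}. C_slice p \<omega> \<delta> Q \<tau> r = C_slice p \<omega> \<delta> Q \<tau> s"
      using const by blast
    show "c = C_slice p \<omega> \<delta> Q \<tau> s"
      if "\<forall>r\<in>{0<..<\<delta>}. C_slice p \<omega> \<delta> Q \<tau> r = c" for c
      using bspec[OF that, of s] assms(4,5) by simp
  qed
qed

end

theory Submission
  imports Defs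
begin

text \<open>
  Write \<open>c\<close>, \<open>\<alpha>\<close>, \<open>\<beta>\<close> for the coordinates of \<open>\<n>\<close> in the orthonormal frame
  \<open>\<omega>\<close>, \<open>\<tau>\<close>, \<open>\<omega> \<times> \<tau>\<close>, and \<open>u\<close>, \<open>v\<close> for the coordinates along \<open>\<tau>\<close> and \<open>\<omega> \<times> \<tau>\<close> of a
  point of the plane that carries \<open>Q\<close>. The constant to compute is
  \<open>2 * \<delta>\<close> times the integral over \<open>Q\<close> of \<open>(\<delta> - \<i> * u) powi (-3)\<close>, a function of \<open>u\<close> alone. Hence
  \<open>v\<close> can be integrated out, which leaves the length of the chord of \<open>Q\<close> at fixed \<open>u\<close>. As \<open>Q\<close> is
  the inside of an ellipse (\<open>cone_section_iff\<close>, by completing squares), this length is a constant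
  multiple of \<open>sqrt (R\<^sup>2 - (u - a)\<^sup>2)\<close>.

  The remaining integral of \<open>sqrt (R\<^sup>2 - (u - a)\<^sup>2) / (\<delta> - \<i> * u) ^ 3\<close> has an elementary primitive
  and equals \<open>pi / 2 * R\<^sup>2 / ((\<delta> - \<i> * a)\<^sup>2 + R\<^sup>2) powr (3 / 2)\<close> for a suitable branch of the root
  (\<open>semicircle_cubic_pole_integral\<close>, \<open>semi_ellipse_cubic_pole_integral\<close>). The final formula
  contains no root because, for the ellipse at hand, the radicand is a perfect square:
  \<open>(\<delta> - \<i> * a)\<^sup>2 + R\<^sup>2 = (\<delta> * (c + \<i> * \<alpha>))\<^sup>2 / (c\<^sup>2 - (sin \<theta>)\<^sup>2)\<close>. This is a trace of the fact that
  the bilinear square of \<open>\<omega> + \<i> * \<tau>\<close> vanishes. A sign of a real part selects the branch, and the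
  constants combine to the stated value (\<open>cone_section_integral\<close>).
\<close>

section \<open>Integrals of semicircle profiles against a cubic pole\<close>

text \<open>
  The Moebius map \<open>T\<close> fixes \<open>1\<close> and \<open>-1\<close> and sends the pole to infinity. With \<open>k\<^sup>2 = 1 - \<kappa>\<^sup>2\<close> it
  turns the integrand into \<open>sqrt (1 - T\<^sup>2) / k ^ 3\<close>, integrated along a circular arc from \<open>-1\<close> to
  \<open>1\<close>; a primitive is half of \<open>T * sqrt (1 - T\<^sup>2) + arcsin T\<close>. Here \<open>w\<close> is the branch of
  \<open>sqrt (1 - T\<^sup>2)\<close> that is continuous along the arc, and \<open>arcsin T\<close> is written as
  \<open>- \<i> * Ln (\<i> * T + w)\<close>. The point to check is that the argument of the logarithm never meets the
  branch cut.
\<close>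
lemma semicircle_cubic_pole_integral:
  fixes \<kappa> :: complex
  assumes \<kappa>: "Im \<kappa> \<noteq> 0"
  shows "((\<lambda>x. of_real (sqrt (1 - x\<^sup>2)) / (1 + of_real x * \<kappa>) ^ 3)
           has_integral of_real (pi / 2) / csqrt (1 - \<kappa>\<^sup>2) ^ 3) {-1..1}"
proof -
  define k where "k = csqrt (1 - \<kappa>\<^sup>2)"
  define T where "T = (\<lambda>x::real. (of_real x + \<kappa>) / (1 + of_real x * \<kappa>))"
  define w where "w = (\<lambda>x::real. k * of_real (sqrt (1 - x\<^sup>2)) / (1 + of_real x * \<kappa>))"
  define \<Phi> where "\<Phi> = (\<lambda>x. (T x * w x - \<i> * Ln (\<i> * T x + w x)) / (2 * k ^ 3))"
  have k2: "k\<^sup>2 = 1 - \<kappa>\<^sup>2" by (simp add: k_def)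
  have nz: "1 + of_real x * \<kappa> \<noteq> 0" for x :: real
    using \<kappa> by (auto simp: complex_eq_iff)
  have fac: "1 - \<kappa>\<^sup>2 = (1 - \<kappa>) * (1 + \<kappa>)" by (simp add: power2_eq_square algebra_simps)
  have k0: "k \<noteq> 0"
  proof -
    have "1 - \<kappa> \<noteq> 0" "1 + \<kappa> \<noteq> 0" using \<kappa> by (auto simp: complex_eq_iff)
    then show ?thesis by (simp add: k_def fac)
  qed
  have circ: "(T x)\<^sup>2 + (w x)\<^sup>2 = 1" if "x\<^sup>2 \<le> 1" for x
  proof -
    have "(of_real (sqrt (1 - x\<^sup>2)) :: complex)\<^sup>2 = 1 - (of_real x)\<^sup>2"
      using that by (simp flip: of_real_power)
    then have "((of_real x + \<kappa>)\<^sup>2 + (k * of_real (sqrt (1 - x\<^sup>2)))\<^sup>2) = (1 + of_real x * \<kappa>)\<^sup>2"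
      by (simp add: power_mult_distrib k2) (simp add: power2_eq_square algebra_simps)
    then show ?thesis
      using nz[of x] by (simp add: T_def w_def power_divide flip: add_divide_distrib)
  qed
  have ImT: "Im (T x) \<noteq> 0" if "x\<^sup>2 < 1" for x
  proof -
    have "Im (T x) = (Im \<kappa> * (1 - x\<^sup>2)) / (cmod (1 + of_real x * \<kappa>))\<^sup>2"
      by (simp add: T_def Im_divide cmod_power2) (simp add: power2_eq_square algebra_simps)
    then show ?thesis using \<kappa> nz[of x] that by simp
  qed
  \<comment> \<open>A purely imaginary value of \<open>w\<close> would make \<open>T\<close> real, so the real part of \<open>w\<close> keeps the
    positive sign that the principal root gives it at \<open>0\<close>.\<close>
  have Rew: "Re (w x) \<noteq> 0" if "x\<^sup>2 < 1" for x
  proof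
    assume "Re (w x) = 0"
    then have w: "w x = \<i> * of_real (Im (w x))" by (simp add: complex_eq_iff)
    have "(w x)\<^sup>2 = - of_real ((Im (w x))\<^sup>2)"
      by (subst w) (simp add: power_mult_distrib)
    then have "(T x)\<^sup>2 = of_real (1 + (Im (w x))\<^sup>2)"
      using circ[of x] that by (simp add: algebra_simps)
    then have *: "Re ((T x)\<^sup>2) = 1 + (Im (w x))\<^sup>2" "Im ((T x)\<^sup>2) = 0" by simp_all
    from *(2) have "Re (T x) = 0" using ImT[OF that] by (simp add: Im_power2)
    then have "Re ((T x)\<^sup>2) \<le> 0" by (simp add: Re_power2)
    then show False using *(1) zero_le_power2[of "Im (w x)"] by linarith
  qed
  have contT: "continuous_on S T" and contw: "continuous_on S w" for S
    unfolding T_def w_def by (intro continuous_intros; use nz in force)+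
  have Rew_pos: "Re (w x) > 0" if x: "x\<^sup>2 < 1" for x
  proof (rule ccontr)
    assume "\<not> Re (w x) > 0"
    moreover have w0: "w 0 = k" by (simp add: w_def)
    have "Re k > 0"
      using csqrt_principal[of "1 - \<kappa>\<^sup>2"] Rew[of 0] by (auto simp: w0 k_def)
    ultimately have "0 \<in> {Re (w x)..Re (w 0)}" by (simp add: w0)
    moreover have "connected ((\<lambda>x. Re (w x)) ` {-1<..<1})"
      by (intro connected_continuous_image continuous_intros contw connected_Ioo)
    moreover have "x \<in> {-1<..<1}" "(0::real) \<in> {-1<..<1}"
      using x by (auto simp: abs_square_less_1 abs_less_iff)
    ultimately have "0 \<in> (\<lambda>x. Re (w x)) ` {-1<..<1}"
      by (meson connected_contains_Icc imageI subsetD)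
    then obtain y where "y \<in> {-1<..<1}" "Re (w y) = 0" by auto
    then show False using Rew[of y] by (auto simp: abs_square_less_1 abs_less_iff)
  qed
  \<comment> \<open>The numbers \<open>\<i> * T + w\<close> and \<open>w - \<i> * T\<close> are mutually inverse with mean value \<open>w\<close>. If one were
    negative, so would be the other, and hence \<open>w\<close>.\<close>
  have slit: "\<i> * T x + w x \<notin> \<real>\<^sub>\<le>\<^sub>0" if x: "x\<^sup>2 < 1" for x
  proof
    assume "\<i> * T x + w x \<in> \<real>\<^sub>\<le>\<^sub>0"
    then obtain r where r: "\<i> * T x + w x = of_real r" "r \<le> 0"
      by (auto elim!: nonpos_Reals_cases)
    have prod: "(\<i> * T x + w x) * (w x - \<i> * T x) = 1"
      using circ[of x] x by (simp add: power2_eq_square algebra_simps)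
    then have rn: "r \<noteq> 0" using r by auto
    then have "w x - \<i> * T x = of_real (1 / r)"
      using prod rn unfolding r(1) by (simp only: of_real_divide of_real_1 eq_divide_eq) (simp add: mult.commute)
    then have "2 * w x = of_real (r + 1 / r)"
    proof -
      have "2 * w x = (\<i> * T x + w x) + (w x - \<i> * T x)" by simp
      then show ?thesis using r(1) \<open>w x - \<i> * T x = _\<close> by simp
    qed
    then have "2 * Re (w x) = r + 1 / r"
      by (simp add: complex_eq_iff del: of_real_add of_real_divide)
    then show False using Rew_pos[OF x] r(2) by (smt (verit) divide_nonneg_nonpos)
  qed
  have ends: "T 1 = 1" "T (-1) = -1" "w 1 = 0" "w (-1) = 0"
    using nz[of 1] nz[of "-1"] by (auto simp: T_def w_def divide_simps)
  have slit': "\<i> * T x + w x \<notin> \<real>\<^sub>\<le>\<^sub>0" if "x \<in> {-1..1}" for x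
  proof (cases "x\<^sup>2 < 1")
    case False
    then have "x = 1 \<or> x = -1" using that by (auto simp: abs_square_less_1 abs_less_iff)
    then show ?thesis by (auto simp: ends complex_nonpos_Reals_iff)
  qed (rule slit)
  have "continuous_on {-1..1} \<Phi>"
    unfolding \<Phi>_def using k0 slit' by (intro continuous_intros contT contw) auto
  moreover have "(\<Phi> has_vector_derivative of_real (sqrt (1 - x\<^sup>2)) / (1 + of_real x * \<kappa>) ^ 3) (at x)"
    if "x \<in> {-1<..<1}" for x
  proof -
    have x: "x\<^sup>2 < 1" using that by (auto simp: abs_square_less_1 abs_less_iff)
    define h where "h = (of_real (sqrt (1 - x\<^sup>2)) :: complex)"
    define d where "d = 1 + of_real x * \<kappa>"
    have d0: "d \<noteq> 0" by (simp add: d_def nz)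
    have h0: "h \<noteq> 0" using x by (simp add: h_def)
    have w0: "w x \<noteq> 0" using Rew[OF x] by auto
    have h2: "h\<^sup>2 = 1 - (of_real x)\<^sup>2"
      using x by (simp add: h_def flip: of_real_power)
    define T' where "T' = k\<^sup>2 / d\<^sup>2"
    have dT: "(T has_vector_derivative T') (at x)"
    proof -
      have "((\<lambda>z. (z + \<kappa>) / (1 + z * \<kappa>)) has_field_derivative T') (at (of_real x))"
        using nz[of x]
        by (auto intro!: derivative_eq_intros simp: T'_def d_def divide_simps power2_eq_square)
           (simp_all add: algebra_simps k2[unfolded power2_eq_square])
      from has_vector_derivative_real_field[OF this] show ?thesis by (simp add: T_def)
    qed
    have dh: "((\<lambda>x. of_real (sqrt (1 - x\<^sup>2)) :: complex) has_vector_derivative (- of_real x / h)) (at x)"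
    proof -
      have "((\<lambda>x. sqrt (1 - x\<^sup>2)) has_real_derivative (- x / sqrt (1 - x\<^sup>2))) (at x)"
        using x by (auto intro!: derivative_eq_intros simp: field_simps)
      then have "((\<lambda>x. of_real (sqrt (1 - x\<^sup>2)) :: complex) has_vector_derivative
          of_real (- x / sqrt (1 - x\<^sup>2))) (at x)"
        by (rule has_vector_derivative_of_real)
      then show ?thesis by (simp add: h_def)
    qed
    \<comment> \<open>This is the derivative of \<open>w\<close> that differentiating \<open>T\<^sup>2 + w\<^sup>2 = 1\<close> predicts.\<close>
    have dw: "(w has_vector_derivative (- T x * T' / w x)) (at x)"
    proof -
      have "(w has_vector_derivative (k * (- of_real x / h) * d - k * h * \<kappa>) / d\<^sup>2) (at x)"
      proof -
        have "((\<lambda>z. k / (1 + z * \<kappa>)) has_field_derivative - (k * \<kappa>) / d\<^sup>2) (at (of_real x))"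
          using nz[of x] by (auto intro!: derivative_eq_intros simp: d_def divide_simps power2_eq_square)
        from has_vector_derivative_mult[OF has_vector_derivative_real_field[OF this] dh]
        show ?thesis
          using d0 by (simp add: w_def flip: h_def d_def) (simp add: field_simps power2_eq_square)
      qed
      moreover have "(k * (- of_real x / h) * d - k * h * \<kappa>) / d\<^sup>2 = - T x * T' / w x"
      proof -
        have "(k * (- of_real x / h) * d - k * h * \<kappa>) / d\<^sup>2 = - k * (of_real x * d + h\<^sup>2 * \<kappa>) / (h * d\<^sup>2)"
          using h0 d0 by (simp add: field_simps power2_eq_square)
        also have "of_real x * d + h\<^sup>2 * \<kappa> = of_real x + \<kappa>"
          unfolding h2 d_def by (simp add: algebra_simps power2_eq_square)
        also have "- k * (of_real x + \<kappa>) / (h * d\<^sup>2) = - T x * T' / w x"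
          using h0 d0 k0 unfolding T_def T'_def w_def h_def[symmetric] d_def[symmetric]
          by (simp add: field_simps power2_eq_square)
        finally show ?thesis .
      qed
      ultimately show ?thesis by simp
    qed
    define W where "W = \<i> * T x + w x"
    have W0: "W \<noteq> 0" using slit[OF x] by (auto simp: W_def)
    have dLn: "((\<lambda>x. Ln (\<i> * T x + w x)) has_vector_derivative ((\<i> * T' - T x * T' / w x) / W)) (at x)"
    proof -
      have "((\<lambda>x. \<i> * T x + w x) has_vector_derivative (\<i> * T' + - T x * T' / w x)) (at x)"
        by (intro has_vector_derivative_add has_vector_derivative_mult_right dT dw)
      moreover have "(Ln has_field_derivative inverse W) (at (\<i> * T x + w x))"
        using slit[OF x] unfolding W_def by (rule has_field_derivative_Ln)
      ultimately show ?thesis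
        using field_vector_diff_chain_at by (fastforce simp: o_def divide_inverse)
    qed
    have d\<Phi>: "(\<Phi> has_vector_derivative (T' * w x + T x * (- T x * T' / w x)
        - \<i> * ((\<i> * T' - T x * T' / w x) / W)) / (2 * k ^ 3)) (at x)"
    proof -
      have "((\<lambda>x. T x * w x) has_vector_derivative (T x * (- T x * T' / w x) + T' * w x)) (at x)"
        by (rule has_vector_derivative_mult[OF dT dw])
      from has_vector_derivative_diff[OF this has_vector_derivative_mult_right[OF dLn, of \<i>]]
      have "((\<lambda>x. T x * w x - \<i> * Ln (\<i> * T x + w x)) has_vector_derivative
         (T x * (- T x * T' / w x) + T' * w x - \<i> * ((\<i> * T' - T x * T' / w x) / W))) (at x)" .
      from has_vector_derivative_divide[OF this, of "2 * k ^ 3"]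
      show ?thesis by (simp add: \<Phi>_def add.commute)
    qed
    have log_term: "(\<i> * T' - T x * T' / w x) / W = \<i> * T' / w x"
    proof -
      have "\<i> * T' - T x * T' / w x = \<i> * T' / w x * W"
        using w0 by (simp add: W_def field_simps)
      then show ?thesis using W0 by simp
    qed
    have numerator: "T' * w x + T x * (- T x * T' / w x) - \<i> * (\<i> * T' / w x) = 2 * w x * T'"
    proof -
      have T2: "1 - (T x)\<^sup>2 = (w x)\<^sup>2" using circ[of x] x by (simp add: algebra_simps)
      have sum: "T' * w x * w x + (1 - (T x)\<^sup>2) * T' = 2 * w x * T' * w x"
        unfolding T2 by (simp add: power2_eq_square)
      have quot: "T' * w x + T x * (- T x * T' / w x) - \<i> * (\<i> * T' / w x)
          = (T' * w x * w x + (1 - (T x)\<^sup>2) * T') / w x"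
        using w0 by (simp add: field_simps power2_eq_square)
      show ?thesis unfolding quot sum using w0 by simp
    qed
    have quotient: "2 * w x * T' / (2 * k ^ 3) = h / d ^ 3"
    proof -
      have wx: "w x = k * h / d" by (simp add: w_def h_def d_def)
      show ?thesis
        unfolding wx T'_def using k0 d0 by (simp add: field_simps power2_eq_square power3_eq_cube)
    qed
    show ?thesis
      using d\<Phi> unfolding log_term numerator quotient by (simp only: h_def d_def)
  qed
  ultimately have "((\<lambda>x. of_real (sqrt (1 - x\<^sup>2)) / (1 + of_real x * \<kappa>) ^ 3)
      has_integral (\<Phi> 1 - \<Phi> (-1))) {-1..1}"
    by (intro fundamental_theorem_of_calculus_interior) auto
  moreover have "\<Phi> 1 - \<Phi> (-1) = of_real (pi / 2) / k ^ 3"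
    using k0 by (simp add: \<Phi>_def ends field_simps)
  ultimately show ?thesis by (simp add: k_def)
qed

text \<open>
  The substitution \<open>u = a + R * x\<close> reduces this to the unit semicircle with
  \<open>\<kappa> = - \<i> * R / (\<delta> - \<i> * a)\<close>. The condition on the real part says that \<open>B / (\<delta> - \<i> * a)\<close> is the
  principal root of \<open>1 - \<kappa>\<^sup>2\<close>, and thus chooses between the two square roots \<open>B\<close> and \<open>- B\<close>.
\<close>

lemma semi_ellipse_cubic_pole_integral:
  fixes B :: complex and a R \<delta> :: real
  assumes \<delta>: "\<delta> > 0" and R: "R > 0"
    and B: "B\<^sup>2 = (of_real \<delta> - \<i> * of_real a)\<^sup>2 + of_real (R\<^sup>2)"
    and branch: "Re (B * cnj (of_real \<delta> - \<i> * of_real a)) > 0"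
  shows "((\<lambda>u. of_real (sqrt (R\<^sup>2 - (u - a)\<^sup>2)) / (of_real \<delta> - \<i> * of_real u) ^ 3)
           has_integral of_real (pi / 2 * R\<^sup>2) / B ^ 3) {a - R..a + R}"
proof -
  define A where "A = of_real \<delta> - \<i> * of_real a"
  define \<kappa> where "\<kappa> = - \<i> * of_real R / A"
  have A0: "A \<noteq> 0" using \<delta> by (auto simp: A_def complex_eq_iff)
  have B0: "B \<noteq> 0" using branch by auto
  have "Im \<kappa> = - (R * \<delta>) / (cmod A)\<^sup>2"
    by (simp add: \<kappa>_def Im_divide cmod_power2) (simp add: A_def)
  then have "Im \<kappa> \<noteq> 0" using A0 \<delta> R by simp
  note unit = semicircle_cubic_pole_integral[OF this]
  have "csqrt (1 - \<kappa>\<^sup>2) = B / A"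
  proof (rule csqrt_unique)
    show "(B / A)\<^sup>2 = 1 - \<kappa>\<^sup>2"
      using A0 B[folded A_def] by (simp add: \<kappa>_def power_divide power_mult_distrib field_simps)
    show "0 < Re (B / A) \<or> Re (B / A) = 0 \<and> 0 \<le> Im (B / A)"
      using branch[folded A_def] by (simp add: Re_complex_div_gt_0)
  qed
  note unit = unit[unfolded this]
  have "((\<lambda>u. of_real (sqrt (1 - ((1 / R) *\<^sub>R u + - a / R)\<^sup>2)) / (1 + of_real ((1 / R) *\<^sub>R u + - a / R) * \<kappa>) ^ 3)
     has_integral (1 / \<bar>1 / R\<bar> ^ DIM(real)) *\<^sub>R (of_real (pi / 2) / (B / A) ^ 3))
     ((\<lambda>x. (1 / (1 / R)) *\<^sub>R x + - ((1 / (1 / R)) *\<^sub>R (- a / R))) ` cbox (-1) 1)"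
    using unit R by (intro has_integral_affinity) auto
  also have "(\<lambda>x. (1 / (1 / R)) *\<^sub>R x + - ((1 / (1 / R)) *\<^sub>R (- a / R))) ` cbox (-1) 1 = {a - R..a + R}"
    using R image_affinity_atLeastAtMost[of R a "-1" 1] by simp
  finally have "((\<lambda>u. of_real (sqrt (1 - ((u - a) / R)\<^sup>2)) / (1 + of_real ((u - a) / R) * \<kappa>) ^ 3)
     has_integral of_real R * (of_real (pi / 2) / (B / A) ^ 3)) {a - R..a + R}"
    using R by (simp add: diff_divide_distrib scaleR_conv_of_real)
  from has_integral_mult_right[OF this, of "of_real R / A ^ 3"]
  have "((\<lambda>u. of_real R / A ^ 3 * (of_real (sqrt (1 - ((u - a) / R)\<^sup>2)) / (1 + of_real ((u - a) / R) * \<kappa>) ^ 3))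
     has_integral of_real (pi / 2 * R\<^sup>2) / B ^ 3) {a - R..a + R}"
    using A0 B0 by (simp add: field_simps power2_eq_square)
  moreover have "of_real R / A ^ 3 * (of_real (sqrt (1 - ((u - a) / R)\<^sup>2)) / (1 + of_real ((u - a) / R) * \<kappa>) ^ 3)
      = of_real (sqrt (R\<^sup>2 - (u - a)\<^sup>2)) / (of_real \<delta> - \<i> * of_real u) ^ 3" for u
  proof -
    have "R * sqrt (1 - ((u - a) / R)\<^sup>2) = sqrt (R\<^sup>2 * (1 - ((u - a) / R)\<^sup>2))"
      using R by (simp add: real_sqrt_mult)
    also have "R\<^sup>2 * (1 - ((u - a) / R)\<^sup>2) = R\<^sup>2 - (u - a)\<^sup>2"
      using R by (simp add: power_divide field_simps)
    finally have "of_real R * of_real (sqrt (1 - ((u - a) / R)\<^sup>2)) = (of_real (sqrt (R\<^sup>2 - (u - a)\<^sup>2)) :: complex)"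
      by (simp flip: of_real_mult)
    moreover have "A * (1 + of_real ((u - a) / R) * \<kappa>) = of_real \<delta> - \<i> * of_real u"
      using A0 R by (simp add: \<kappa>_def field_simps) (simp add: A_def algebra_simps)
    then have "A ^ 3 * (1 + of_real ((u - a) / R) * \<kappa>) ^ 3 = (of_real \<delta> - \<i> * of_real u) ^ 3"
      by (simp flip: power_mult_distrib)
    ultimately show ?thesis by (simp only: times_divide_times_eq)
  qed
  ultimately show ?thesis by simp
qed

section \<open>Integrating out one variable\<close>

text \<open>
  Fubini for a function of the first variable on the region between the graphs of \<open>m - sqrt r\<close> and
  \<open>m + sqrt r\<close>. The maximum with \<open>0\<close> accounts for empty slices.
\<close>

lemma integral_between_graphs:
  fixes g :: "real \<Rightarrow> complex" and m r :: "real \<Rightarrow> real"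
  assumes g: "continuous_on UNIV g" and m: "continuous_on UNIV m" and r: "continuous_on UNIV r"
    and out: "\<And>u. u \<notin> {l..h} \<Longrightarrow> r u \<le> 0"
  shows "(LINT w|lborel. indicator {(u, v). (v - m u)\<^sup>2 < r u} w *\<^sub>R g (fst w))
    = integral {l..h} (\<lambda>u. (2 * sqrt (max 0 (r u))) *\<^sub>R g u)"
proof -
  define S where "S = {(u, v). (v - m u)\<^sup>2 < r u}"
  define f where "f = (\<lambda>w. indicator S w *\<^sub>R g (fst w))"
  have [measurable]: "g \<in> borel_measurable borel" "m \<in> borel_measurable borel" "r \<in> borel_measurable borel"
    using g m r by (auto intro: borel_measurable_continuous_onI)
  have [measurable]: "S \<in> sets (borel \<Otimes>\<^sub>M borel)"
  proof -
    have "S = {w \<in> space (borel \<Otimes>\<^sub>M borel). (snd w - m (fst w))\<^sup>2 < r (fst w)}"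
      by (auto simp: S_def space_pair_measure)
    also have "\<dots> \<in> sets (borel \<Otimes>\<^sub>M borel)" by measurable
    finally show ?thesis .
  qed
  have fm: "f \<in> borel_measurable (lborel \<Otimes>\<^sub>M lborel)"
    unfolding f_def by measurable
  have sl: "indicator S (u, v) = (indicator {m u - sqrt (max 0 (r u))<..<m u + sqrt (max 0 (r u))} v :: real)" for u v
  proof -
    have "(v - m u)\<^sup>2 < r u \<longleftrightarrow> \<bar>v - m u\<bar> < sqrt (max 0 (r u))"
      by (smt (verit) real_sqrt_abs real_sqrt_less_iff zero_le_power2 real_sqrt_le_iff max_def)
    then show ?thesis by (auto simp: S_def indicator_def abs_less_iff)
  qed
  have inner: "(LINT v|lborel. f (u, v)) = (2 * sqrt (max 0 (r u))) *\<^sub>R g u" for u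
    unfolding f_def sl by simp
  have innern: "(LINT v|lborel. norm (f (u, v))) = (2 * sqrt (max 0 (r u))) * norm (g u)" for u
    unfolding f_def sl by (simp add: abs_indicator)
  have supp: "sqrt (max 0 (r u)) = indicator {l..h} u * sqrt (max 0 (r u))" for u
    using out[of u] by (cases "u \<in> {l..h}") (auto simp: indicator_def)
  have c1: "continuous_on {l..h} (\<lambda>u. (2 * sqrt (max 0 (r u))) *\<^sub>R g u)"
    using g r by (intro continuous_intros) (auto intro: continuous_on_subset)
  have c2: "continuous_on {l..h} (\<lambda>u. (2 * sqrt (max 0 (r u))) * norm (g u))"
    using g r by (intro continuous_intros) (auto intro: continuous_on_subset)
  have int: "integrable (lborel \<Otimes>\<^sub>M lborel) f"
  proof (rule lborel_pair.Fubini_integrable[OF fm])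
    have "set_integrable lborel {l..h} (\<lambda>u. (2 * sqrt (max 0 (r u))) * norm (g u))"
      by (rule borel_integrable_atLeastAtMost'[OF c2])
    then show "integrable lborel (\<lambda>u. LINT v|lborel. norm (f (u, v)))"
      unfolding innern set_integrable_def by (subst supp) (simp add: mult_ac)
    show "AE u in lborel. integrable lborel (\<lambda>v. f (u, v))"
      unfolding f_def sl by (intro AE_I2) simp
  qed
  have "(LINT w|lborel. f w) = (LINT u|lborel. LINT v|lborel. f (u, v))"
    using lborel_pair.integral_fst'[OF int] by (simp add: lborel_prod)
  also have "\<dots> = (LINT u:{l..h}|lborel. (2 * sqrt (max 0 (r u))) *\<^sub>R g u)"
    unfolding inner set_lebesgue_integral_def by (subst supp) (simp add: mult_ac)
  also have "\<dots> = integral {l..h} (\<lambda>u. (2 * sqrt (max 0 (r u))) *\<^sub>R g u)"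
    by (rule set_borel_integral_eq_integral(2)[OF borel_integrable_atLeastAtMost'[OF c1]])
  finally show ?thesis by (simp add: f_def S_def)
qed


section \<open>The elliptic section of the cone\<close>

text \<open>
  Squaring the cone inequality is harmless because its left side is always larger than
  \<open>- C * sqrt (\<delta>\<^sup>2 + u\<^sup>2 + v\<^sup>2)\<close>: by Cauchy-Schwarz this follows from \<open>\<alpha>\<^sup>2 + \<beta>\<^sup>2 = 1 - c\<^sup>2 \<le> C\<^sup>2\<close>,
  which is where \<open>S < c\<close> enters; geometrically, the plane misses the opposite nappe. Completing the
  square, first in \<open>v\<close> and then in \<open>u\<close>, gives the ellipse. Its coefficients are positive since
  \<open>E > 0\<close> and \<open>D = E + \<alpha>\<^sup>2\<close>.
\<close>

lemma cone_section_iff: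
  fixes c \<alpha> \<beta> C S \<delta> u v :: real
  assumes unit: "c\<^sup>2 + \<alpha>\<^sup>2 + \<beta>\<^sup>2 = 1" "C\<^sup>2 + S\<^sup>2 = 1" and pos: "0 < C" "0 < S" "S < c" "0 < \<delta>"
  defines "D \<equiv> C\<^sup>2 - \<beta>\<^sup>2" and "E \<equiv> c\<^sup>2 - S\<^sup>2"
  shows "\<delta> * c - u * \<alpha> - v * \<beta> > C * sqrt (\<delta>\<^sup>2 + u\<^sup>2 + v\<^sup>2) \<longleftrightarrow>
     (v - (- \<beta> * (\<delta> * c - u * \<alpha>) / D))\<^sup>2 < C\<^sup>2 * E / D\<^sup>2 * ((\<delta> * S * sqrt D / E)\<^sup>2 - (u - (- \<delta> * c * \<alpha> / E))\<^sup>2)"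
proof -
  define L where "L = \<delta> * c - u * \<alpha> - v * \<beta>"
  define N where "N = \<delta>\<^sup>2 + u\<^sup>2 + v\<^sup>2"
  have E0: "E > 0" using pos by (simp add: E_def power_strict_mono)
  have DE: "D = E + \<alpha>\<^sup>2" using unit by (simp add: D_def E_def)
  have D0: "D > 0" using E0 zero_le_power2[of \<alpha>] unfolding DE by linarith
  have ab: "\<alpha>\<^sup>2 + \<beta>\<^sup>2 \<le> C\<^sup>2" using unit E0 by (simp add: E_def)
  have "(u * \<alpha> + v * \<beta>)\<^sup>2 \<le> (\<alpha>\<^sup>2 + \<beta>\<^sup>2) * (u\<^sup>2 + v\<^sup>2)"
    using zero_le_power2[of "u * \<beta> - v * \<alpha>"] by (simp add: power2_eq_square algebra_simps)
  also have "\<dots> \<le> C\<^sup>2 * N"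
    using ab by (intro mult_mono) (auto simp: N_def)
  finally have "\<bar>u * \<alpha> + v * \<beta>\<bar> \<le> sqrt (C\<^sup>2 * N)"
    using real_le_rsqrt by simp
  then have "\<bar>u * \<alpha> + v * \<beta>\<bar> \<le> C * sqrt N"
    using pos by (simp add: real_sqrt_mult)
  moreover have "\<delta> * c > 0" using pos by simp
  ultimately have low: "- (C * sqrt N) < L" by (simp add: L_def)
  have "L > C * sqrt N \<longleftrightarrow> \<bar>C * sqrt N\<bar> < \<bar>L\<bar>"
    using low pos by (auto simp: abs_mult N_def)
  also have "\<dots> \<longleftrightarrow> C\<^sup>2 * N < L\<^sup>2"
    unfolding not_le[symmetric] abs_le_square_iff by (simp add: power_mult_distrib N_def)
  also have "\<dots> \<longleftrightarrow> 0 < (L\<^sup>2 - C\<^sup>2 * N) / D" using D0 by (auto simp: zero_less_divide_iff)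
  also have "(L\<^sup>2 - C\<^sup>2 * N) / D = C\<^sup>2 * E / D\<^sup>2 * ((\<delta> * S * sqrt D / E)\<^sup>2 - (u - (- \<delta> * c * \<alpha> / E))\<^sup>2)
      - (v - (- \<beta> * (\<delta> * c - u * \<alpha>) / D))\<^sup>2"
  proof -
    define M where "M = \<delta> * c - u * \<alpha>"
    define X where "X = M\<^sup>2 - D * (\<delta>\<^sup>2 + u\<^sup>2)"
    \<comment> \<open>The square is completed in \<open>v\<close> here, and in \<open>u\<close> below.\<close>
    have 1: "(L\<^sup>2 - C\<^sup>2 * N) * D + (D * v + \<beta> * M)\<^sup>2 = C\<^sup>2 * X"
      unfolding L_def N_def X_def M_def D_def by (simp add: power2_eq_square algebra_simps)
    have c2: "c\<^sup>2 = E + S\<^sup>2" by (simp add: E_def)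
    have "X * E = \<delta>\<^sup>2 * (c\<^sup>2 - D) * E - 2 * E * \<delta> * c * u * \<alpha> - E\<^sup>2 * u\<^sup>2"
      unfolding X_def M_def DE by (simp add: power2_eq_square algebra_simps)
    also have "\<dots> = \<delta>\<^sup>2 * S\<^sup>2 * D - \<delta>\<^sup>2 * c\<^sup>2 * \<alpha>\<^sup>2 - 2 * E * \<delta> * c * u * \<alpha> - E\<^sup>2 * u\<^sup>2"
      unfolding DE c2 by (simp add: power2_eq_square algebra_simps)
    also have "\<dots> = \<delta>\<^sup>2 * S\<^sup>2 * D - (E * u + \<delta> * c * \<alpha>)\<^sup>2"
      by (simp add: power2_eq_square algebra_simps)
    finally have 2: "X * E = \<delta>\<^sup>2 * S\<^sup>2 * D - (E * u + \<delta> * c * \<alpha>)\<^sup>2" .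
    have "(\<delta> * S * sqrt D / E)\<^sup>2 - (u - (- \<delta> * c * \<alpha> / E))\<^sup>2 = X * E / E\<^sup>2"
    proof -
      have "u - (- \<delta> * c * \<alpha> / E) = (E * u + \<delta> * c * \<alpha>) / E"
        using E0 by (simp add: field_simps)
      then show ?thesis
        unfolding 2 using D0 by (simp add: power_divide power_mult_distrib diff_divide_distrib)
    qed
    moreover have "v - (- \<beta> * (\<delta> * c - u * \<alpha>) / D) = (D * v + \<beta> * M) / D"
      using D0 by (simp add: M_def field_simps)
    moreover have "(L\<^sup>2 - C\<^sup>2 * N) / D = (C\<^sup>2 * X - (D * v + \<beta> * M)\<^sup>2) / D\<^sup>2"
    proof -
      have "(L\<^sup>2 - C\<^sup>2 * N) * D = C\<^sup>2 * X - (D * v + \<beta> * M)\<^sup>2" using 1 by simp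
      then have "(L\<^sup>2 - C\<^sup>2 * N) * D / D\<^sup>2 = (C\<^sup>2 * X - (D * v + \<beta> * M)\<^sup>2) / D\<^sup>2" by simp
      then show ?thesis using D0 by (simp add: power2_eq_square[of D])
    qed
    ultimately show ?thesis
      using E0 by (simp add: power_divide diff_divide_distrib) (simp add: power2_eq_square)
  qed
  finally show ?thesis by (simp add: L_def N_def)
qed


text \<open>
  The numbers \<open>a\<close>, \<open>R\<close>, \<open>m\<close>, \<open>r\<close> describe the ellipse as in the preceding lemma, and \<open>B\<close> is the square root of
  \<open>(\<delta> - \<i> * a)\<^sup>2 + R\<^sup>2\<close>, which is explicit and linear in \<open>c + \<i> * \<alpha>\<close>. That \<open>B\<close> lies on the required branch
  follows from \<open>c > 0\<close>.
\<close>

lemma cone_section_integral: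
  fixes c \<alpha> \<beta> C S \<delta> :: real
  assumes unit: "c\<^sup>2 + \<alpha>\<^sup>2 + \<beta>\<^sup>2 = 1" "C\<^sup>2 + S\<^sup>2 = 1" and pos: "0 < C" "0 < S" "S < c" "0 < \<delta>"
  shows "(LINT w|lborel. indicator {(u, v). \<delta> * c - u * \<alpha> - v * \<beta> > C * sqrt (\<delta>\<^sup>2 + u\<^sup>2 + v\<^sup>2)} w *\<^sub>R
            (1 / (of_real \<delta> - \<i> * of_real (fst w)) ^ 3))
     = of_real (pi * C * S\<^sup>2) / (of_real \<delta> * (of_real c + \<i> * of_real \<alpha>) ^ 3)"
proof -
  define D where "D = C\<^sup>2 - \<beta>\<^sup>2"
  define E where "E = c\<^sup>2 - S\<^sup>2"
  define a where "a = - \<delta> * c * \<alpha> / E"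
  define R where "R = \<delta> * S * sqrt D / E"
  define m where "m = (\<lambda>u. - \<beta> * (\<delta> * c - u * \<alpha>) / D)"
  define r where "r = (\<lambda>u. C\<^sup>2 * E / D\<^sup>2 * (R\<^sup>2 - (u - a)\<^sup>2))"
  define g where "g = (\<lambda>u::real. 1 / (of_real \<delta> - \<i> * of_real u) ^ 3 :: complex)"
  define B where "B = of_real (\<delta> / sqrt E) * (of_real c + \<i> * of_real \<alpha>)"
  have E0: "E > 0" using pos by (simp add: E_def power_strict_mono)
  have DE: "D = E + \<alpha>\<^sup>2" using unit by (simp add: D_def E_def)
  have D0: "D > 0" using E0 zero_le_power2[of \<alpha>] unfolding DE by linarith
  have c0: "c > 0" using pos by simp
  have R0: "R > 0" using pos E0 D0 by (simp add: R_def)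
  have nz: "of_real \<delta> - \<i> * of_real u \<noteq> (0 :: complex)" for u :: real
    using pos by (auto simp: complex_eq_iff)
  have set_eq: "{(u, v). \<delta> * c - u * \<alpha> - v * \<beta> > C * sqrt (\<delta>\<^sup>2 + u\<^sup>2 + v\<^sup>2)} = {(u, v). (v - m u)\<^sup>2 < r u}"
    unfolding m_def r_def R_def a_def D_def E_def using cone_section_iff[OF unit pos] by simp
  have out: "r u \<le> 0" if "u \<notin> {a - R..a + R}" for u
  proof -
    have "\<bar>R\<bar> \<le> \<bar>u - a\<bar>" using that R0 by auto
    then have "R\<^sup>2 \<le> (u - a)\<^sup>2" by (simp only: abs_le_square_iff)
    then show ?thesis unfolding r_def by (intro mult_nonneg_nonpos) (use E0 in auto)
  qed
  have sqrt_r: "sqrt (max 0 (r u)) = C * sqrt E / D * sqrt (R\<^sup>2 - (u - a)\<^sup>2)" if "u \<in> {a - R..a + R}" for u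
  proof -
    have "\<bar>u - a\<bar> \<le> \<bar>R\<bar>" using that R0 by auto
    then have "(u - a)\<^sup>2 \<le> R\<^sup>2" by (simp only: abs_le_square_iff)
    then have "0 \<le> r u" using E0 by (auto simp: r_def)
    then show ?thesis using pos D0
      by (simp add: max_def r_def real_sqrt_mult real_sqrt_divide)
  qed
  have B2: "B\<^sup>2 = (of_real \<delta> - \<i> * of_real a)\<^sup>2 + of_real (R\<^sup>2)"
  proof -
    have R2: "R\<^sup>2 = \<delta>\<^sup>2 * S\<^sup>2 * D / E\<^sup>2"
      using D0 by (simp add: R_def power_divide power_mult_distrib)
    have "(c\<^sup>2 - \<alpha>\<^sup>2) * E = E\<^sup>2 - c\<^sup>2 * \<alpha>\<^sup>2 + S\<^sup>2 * D"
      unfolding DE by (simp add: E_def power2_eq_square algebra_simps)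
    moreover have "(\<delta> / sqrt E)\<^sup>2 * (c\<^sup>2 - \<alpha>\<^sup>2) = \<delta>\<^sup>2 * ((c\<^sup>2 - \<alpha>\<^sup>2) * E) / E\<^sup>2"
      using E0 by (simp add: power_divide power2_eq_square[of E])
    ultimately have "(\<delta> / sqrt E)\<^sup>2 * (c\<^sup>2 - \<alpha>\<^sup>2) = \<delta>\<^sup>2 * (E\<^sup>2 - c\<^sup>2 * \<alpha>\<^sup>2 + S\<^sup>2 * D) / E\<^sup>2"
      by simp
    also have "\<dots> = \<delta>\<^sup>2 - a\<^sup>2 + R\<^sup>2"
      using E0 unfolding R2 a_def by (simp add: power_divide power_mult_distrib field_simps)
    finally have "(\<delta> / sqrt E)\<^sup>2 * (c\<^sup>2 - \<alpha>\<^sup>2) = \<delta>\<^sup>2 - a\<^sup>2 + R\<^sup>2" .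
    moreover have "(\<delta> / sqrt E)\<^sup>2 * (2 * c * \<alpha>) = - 2 * \<delta> * a"
      using E0 unfolding a_def by (simp add: power_divide power2_eq_square)
    ultimately have "of_real ((\<delta> / sqrt E)\<^sup>2 * (c\<^sup>2 - \<alpha>\<^sup>2)) + \<i> * of_real ((\<delta> / sqrt E)\<^sup>2 * (2 * c * \<alpha>))
        = of_real (\<delta>\<^sup>2 - a\<^sup>2 + R\<^sup>2) + \<i> * of_real (- 2 * \<delta> * a)"
      by (simp only:)
    moreover have "B\<^sup>2 = of_real ((\<delta> / sqrt E)\<^sup>2 * (c\<^sup>2 - \<alpha>\<^sup>2)) + \<i> * of_real ((\<delta> / sqrt E)\<^sup>2 * (2 * c * \<alpha>))"
    proof -
      have "B\<^sup>2 = of_real ((\<delta> / sqrt E)\<^sup>2) * (of_real c + \<i> * of_real \<alpha>)\<^sup>2"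
        by (simp only: B_def power_mult_distrib of_real_power)
      also have "(of_real c + \<i> * of_real \<alpha>)\<^sup>2 = of_real (c\<^sup>2 - \<alpha>\<^sup>2) + \<i> * of_real (2 * c * \<alpha>)"
        by (simp add: complex_eq_iff Re_power2 Im_power2)
      finally show ?thesis by (simp only: of_real_mult distrib_left mult.left_commute)
    qed
    moreover have "(of_real \<delta> - \<i> * of_real a)\<^sup>2 + of_real (R\<^sup>2)
        = of_real (\<delta>\<^sup>2 - a\<^sup>2 + R\<^sup>2) + \<i> * of_real (- 2 * \<delta> * a)"
      by (simp add: complex_eq_iff Re_power2 Im_power2)
    ultimately show ?thesis by (simp only:)
  qed
  have branch: "Re (B * cnj (of_real \<delta> - \<i> * of_real a)) > 0"
  proof -
    have "Re (B * cnj (of_real \<delta> - \<i> * of_real a)) = \<delta> / sqrt E * (c * \<delta> - \<alpha> * a)"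
      by (simp add: B_def algebra_simps)
    also have "c * \<delta> - \<alpha> * a = c * \<delta> * (1 + \<alpha>\<^sup>2 / E)"
      by (simp add: a_def algebra_simps power2_eq_square)
    finally show ?thesis
      using pos c0 E0 by (simp add: add_pos_nonneg)
  qed
  have B3: "B ^ 3 = of_real (\<delta> ^ 3 / (E * sqrt E)) * (of_real c + \<i> * of_real \<alpha>) ^ 3"
    using E0 by (simp add: B_def power_mult_distrib power_divide power3_eq_cube flip: of_real_mult)
  have "(LINT w|lborel. indicator {(u, v). (v - m u)\<^sup>2 < r u} w *\<^sub>R g (fst w))
      = integral {a - R..a + R} (\<lambda>u. (2 * sqrt (max 0 (r u))) *\<^sub>R g u)"
    unfolding m_def r_def g_def using out D0 nz
    by (intro integral_between_graphs continuous_intros) (auto simp: r_def)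
  also have "\<dots> = integral {a - R..a + R} (\<lambda>u. of_real (2 * (C * sqrt E / D)) *
        (of_real (sqrt (R\<^sup>2 - (u - a)\<^sup>2)) / (of_real \<delta> - \<i> * of_real u) ^ 3))"
    by (rule integral_cong) (simp add: sqrt_r g_def scaleR_conv_of_real)
  also have "\<dots> = of_real (2 * (C * sqrt E / D)) * (of_real (pi / 2 * R\<^sup>2) / B ^ 3)"
    by (intro integral_unique has_integral_mult_right
        semi_ellipse_cubic_pole_integral[OF \<open>0 < \<delta>\<close> R0 B2 branch])
  also have "\<dots> = of_real (2 * (C * sqrt E / D) * (pi / 2 * R\<^sup>2) / (\<delta> ^ 3 / (E * sqrt E))) / (of_real c + \<i> * of_real \<alpha>) ^ 3"
    unfolding B3 by (simp add: mult_ac)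
  also have "2 * (C * sqrt E / D) * (pi / 2 * R\<^sup>2) / (\<delta> ^ 3 / (E * sqrt E)) = pi * C * S\<^sup>2 / \<delta>"
  proof -
    have "sqrt E * sqrt E = E" using E0 by simp
    then show ?thesis
      using E0 D0 pos by (simp add: R_def power_divide power_mult_distrib field_simps power2_eq_square power3_eq_cube)
  qed
  finally show ?thesis by (simp add: set_eq g_def)
qed

section \<open>The constant of the circular cone\<close>

lemma openin_cone_section:
  "openin (top_of_set (plane \<omega> k)) (circ_cone p d \<theta> \<inter> plane \<omega> k)"
proof -
  have "open (circ_cone p d \<theta>)"
    unfolding circ_cone_def by (intro open_Collect_less continuous_intros)
  then show ?thesis by (auto simp: openin_open)
qed

lemma plane_frame_cross3:
  assumes "norm \<omega> = 1" "norm \<tau> = 1" "\<tau> \<bullet> \<omega> = 0"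
  shows "plane_frame \<omega> \<tau> (cross3 \<omega> \<tau>)"
proof -
  have "(norm (cross3 \<omega> \<tau>))\<^sup>2 = 1"
    using norm_cross_dot[of \<omega> \<tau>] assms by (simp add: inner_commute power2_eq_square)
  then have "norm (cross3 \<omega> \<tau>) = 1"
    by (metis abs_norm_cancel real_sqrt_abs real_sqrt_one)
  then show ?thesis
    using assms by (simp add: plane_frame_def dot_cross_self)
qed

lemma cdot_cvec: "cdot (cvec x) (cvec y) = of_real (x \<bullet> y)"
  by (simp add: cdot_def cvec_def inner_vec_def)

lemma cdot_linear_right: "cdot x (y + k *s z) = cdot x y + k * cdot x z"
  by (simp add: cdot_def sum.distrib sum_distrib_left algebra_simps)

theorem proposition1p3:
  fixes p \<n> \<omega> :: "real^3" and \<theta> \<delta> :: real and Q :: "(real^3) set"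
  assumes "\<n> \<in> sphere 0 1" and "\<omega> \<in> sphere 0 1"
    and "0 < \<theta>" and "\<theta> < pi / 2" and "0 < \<delta>"
    and "\<omega> \<bullet> \<n> > sin \<theta>"
    and "Q = circ_cone p (- \<n>) \<theta> \<inter> plane \<omega> (p \<bullet> \<omega> - \<delta>)"
  shows "\<forall>\<tau>\<in>sphere 0 1. \<tau> \<bullet> \<omega> = 0 \<longrightarrow>
    C_const p \<omega> \<delta> Q \<tau> =
      6 * of_real (cone_volume \<theta>) * cdot (cvec \<n>) (cvec \<omega> + \<i> *s cvec \<tau>) powi (- 3)"
proof (intro ballI impI)
  fix \<tau> :: "real^3" assume "\<tau> \<in> sphere 0 1" and \<tau>\<omega>: "\<tau> \<bullet> \<omega> = 0"
  then have n: "norm \<n> = 1" and w: "norm \<omega> = 1" and t: "norm \<tau> = 1"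
    using assms(1,2) by auto
  define b where "b = cross3 \<omega> \<tau>"
  have fr: "plane_frame \<omega> \<tau> b" unfolding b_def by (rule plane_frame_cross3[OF w t \<tau>\<omega>])
  have dots: "\<omega> \<bullet> \<omega> = 1" "\<tau> \<bullet> \<tau> = 1" "b \<bullet> b = 1" "\<tau> \<bullet> b = 0" "b \<bullet> \<tau> = 0" "b \<bullet> \<omega> = 0" "\<omega> \<bullet> b = 0" "\<omega> \<bullet> \<tau> = 0"
    using fr w t \<tau>\<omega> by (auto simp: plane_frame_def norm_eq_1 inner_commute)
  define c \<alpha> \<beta> where "c = \<omega> \<bullet> \<n>" and "\<alpha> = \<tau> \<bullet> \<n>" and "\<beta> = b \<bullet> \<n>"
  note c\<alpha>\<beta> = c_def \<alpha>_def \<beta>_def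
  have unit: "c\<^sup>2 + \<alpha>\<^sup>2 + \<beta>\<^sup>2 = 1"
    using n arg_cong[OF plane_frame_expand[OF w fr, of \<n>], of "\<lambda>z. z \<bullet> \<n>"]
    by (simp add: norm_eq_1 inner_add_left c\<alpha>\<beta> power2_eq_square
        inner_commute[of \<n> \<omega>] inner_commute[of \<n> \<tau>] inner_commute[of \<n> b])
  have op: "openin (top_of_set (plane \<omega> (p \<bullet> \<omega> - \<delta>))) Q"
    using assms(7) openin_cone_section by simp
  have "closed (plane \<omega> (p \<bullet> \<omega> - \<delta>))"
    using closed_hyperplane[of \<omega>] by (simp add: plane_def inner_commute)
  with op have Qm [measurable]: "Q \<in> sets borel"
    by (auto simp: openin_open borel_closed)
  define G where "G = plane_chart (p - \<delta> *\<^sub>R \<omega>) \<tau> b"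
  have Gm [measurable]: "G \<in> borel_measurable borel" by (simp add: G_def)
  have G: "G (u, v) - p = - \<delta> *\<^sub>R \<omega> + u *\<^sub>R \<tau> + v *\<^sub>R b" for u v
    by (simp add: G_def plane_chart_def)
  have G\<tau>: "(G x - p) \<bullet> \<tau> = fst x" for x
    by (cases x) (simp add: G inner_add_left inner_diff_left dots)
  have Gn: "(G (u, v) - p) \<bullet> (- \<n>) = \<delta> * c - u * \<alpha> - v * \<beta>" for u v
    by (simp add: G inner_add_left inner_diff_left c\<alpha>\<beta>)
  have Gnorm: "norm (G (u, v) - p) = sqrt (\<delta>\<^sup>2 + u\<^sup>2 + v\<^sup>2)" for u v
    by (simp add: G norm_eq_sqrt_inner inner_add_left inner_add_right inner_diff_left inner_diff_right dots \<tau>\<omega> power2_eq_square)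
  have Gplane: "G x \<in> plane \<omega> (p \<bullet> \<omega> - \<delta>)" for x
    by (cases x) (simp add: plane_def G_def plane_chart_def inner_add_left inner_diff_left dots \<tau>\<omega>)
  have ind: "indicator Q (G x) = (indicator
      {(u, v). \<delta> * c - u * \<alpha> - v * \<beta> > cos \<theta> * sqrt (\<delta>\<^sup>2 + u\<^sup>2 + v\<^sup>2)} x :: real)" for x
  proof (cases x)
    case (Pair u v)
    then show ?thesis
      unfolding assms(7) circ_cone_def using Gplane[of x]
      by (simp add: indicator_def Gn Gnorm mult.commute del: inner_minus_right)
  qed
  \<comment> \<open>Every slice gives the same value; the slice at \<open>\<delta> / 2\<close> serves to reach the integral over \<open>Q\<close>.\<close>
  have "C_const p \<omega> \<delta> Q \<tau> = C_slice p \<omega> \<delta> Q \<tau> (\<delta> / 2)"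
    using assms(5) by (intro C_const_eq[OF w \<tau>\<omega> op]) auto
  also have "\<dots> = 2 * of_real \<delta> *
     (LINT z:Q|plane_area \<omega> (p \<bullet> \<omega> - \<delta>). 1 / (of_real \<delta> - \<i> * of_real ((z - p) \<bullet> \<tau>)) ^ 3)"
    using assms(5) by (intro C_slice_eq[OF w \<tau>\<omega> openin_imp_subset[OF op] Qm]) auto
  also have "plane_area \<omega> (p \<bullet> \<omega> - \<delta>) = distr lborel borel G"
    unfolding G_def by (rule plane_area_eq[OF w fr]) (simp add: inner_diff_left dots)
  also have "(LINT z:Q|distr lborel borel G. 1 / (of_real \<delta> - \<i> * of_real ((z - p) \<bullet> \<tau>)) ^ 3)
     = (LINT x|lborel. indicator Q (G x) *\<^sub>R (1 / (of_real \<delta> - \<i> * of_real ((G x - p) \<bullet> \<tau>)) ^ 3 :: complex))"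
    unfolding set_lebesgue_integral_def by (rule integral_distr) measurable
  also have "\<dots> = of_real (pi * cos \<theta> * (sin \<theta>)\<^sup>2) / (of_real \<delta> * (of_real c + \<i> * of_real \<alpha>) ^ 3)"
    unfolding ind G\<tau>
    using assms(3-6) by (intro cone_section_integral unit) (auto simp: c_def cos_gt_zero sin_gt_zero)
  also have "2 * of_real \<delta> * \<dots> = 6 * of_real (cone_volume \<theta>) / (of_real c + \<i> * of_real \<alpha>) ^ 3"
    using assms(5) by (simp add: cone_volume_def)
  also have "\<dots> = 6 * of_real (cone_volume \<theta>) * cdot (cvec \<n>) (cvec \<omega> + \<i> *s cvec \<tau>) powi (- 3)"
    by (simp add: cdot_linear_right cdot_cvec c\<alpha>\<beta> inner_commute power_int_minus divide_inverse)
  finally show "C_const p \<omega> \<delta> Q \<tau>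
      = 6 * of_real (cone_volume \<theta>) * cdot (cvec \<n>) (cvec \<omega> + \<i> *s cvec \<tau>) powi (- 3)" .
qed

end
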